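(* Let $(X,\langle\cdot|\cdot\rangle)$ be a complex inner product space and let $x,y\in X$ be two unit vectors with $x+y\neq0$. Then the equation $$\angle(x,y)=\angle(x,x+y)+\angle(x+y,y)$$ holds if and only if $(x,y)\in\mathcal R_X$, i.e. if and only if the angle $\angle(x,y)$ is real.
   Context: A complex inner product is homogeneous over $\mathbb C$ in the first component, conjugate symmetric, positive definite and additive, and $\|x\|=\sqrt{\langle x|x\rangle}$. $\mathcal R_X:=\{(x,y)\in X\times X\mid\langle x|y\rangle\in\mathbb R\}$. For $x,y\in X\setminus\{0\}$ the angle is $\angle(x,y):=\arccos\big(\langle x|y\rangle/(\|x\|\,\|y\|)\big)$, where $\arccos:\mathcal B\to\mathcal A$ is the inverse of the homeomorphism $\cos:\mathcal A\to\mathcal B$ obtained by restricting the complex cosine, with $\mathcal A:=\{a+ib\mid 0<a<\pi,\ b\in\mathbb R\}\cup\{0,\pi\}$ and $\mathcal B:=\mathbb C\setminus\{r\in\mathbb R\mid r<-1\text{ or }r>1\}$. *)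

theory Defs
  imports "HOL-Analysis.Analysis"
begin

locale complex_inner_product_space = vector_space scale
  for scale :: "complex \<Rightarrow> 'a::ab_group_add \<Rightarrow> 'a" (infixr "*\<^sub>V" 75) +
  fixes ip :: "'a \<Rightarrow> 'a \<Rightarrow> complex"
  assumes ip_scale_left: "ip (c *\<^sub>V x) y = c * ip x y"
    and ip_add_left: "ip (x + y) z = ip x z + ip y z"
    and ip_cnj: "ip x y = cnj (ip y x)"
    and ip_pos_def: "x \<noteq> 0 \<Longrightarrow> ip x x \<in> \<real> \<and> Re (ip x x) > 0"

definition ip_norm :: "('a \<Rightarrow> 'a \<Rightarrow> complex) \<Rightarrow> 'a \<Rightarrow> real" where
  "ip_norm ip x = sqrt (Re (ip x x))"

definition real_pairs :: "('a \<Rightarrow> 'a \<Rightarrow> complex) \<Rightarrow> ('a \<times> 'a) set" where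
  "real_pairs ip = {(x, y). ip x y \<in> \<real>}"

definition angle_strip :: "complex set" where
  "angle_strip = {Complex a b | a b. 0 < a \<and> a < pi} \<union> {0, of_real pi}"

definition slit_plane :: "complex set" where
  "slit_plane = - {of_real r | r. r < -1 \<or> r > 1}"

text \<open>Meaningful on \<open>slit_plane\<close> only, where it agrees with the library's \<open>Arccos\<close>
  (see \<open>strip_arccos_eq_Arccos\<close> below).\<close>
definition strip_arccos :: "complex \<Rightarrow> complex" where
  "strip_arccos = the_inv_into angle_strip cos"

text \<open>Meaningful for nonzero \<open>x\<close> and \<open>y\<close> only; the argument of \<open>strip_arccos\<close> is then
  in \<open>slit_plane\<close> by the Cauchy-Schwarz inequality.\<close>
definition ip_angle :: "('a \<Rightarrow> 'a \<Rightarrow> complex) \<Rightarrow> 'a \<Rightarrow> 'a \<Rightarrow> complex" where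
  "ip_angle ip x y = strip_arccos (ip x y / of_real (ip_norm ip x * ip_norm ip y))"

lemma Arccos_cos_strip: "z \<in> angle_strip \<Longrightarrow> Arccos (cos z) = z"
  by (rule Arccos_cos) (auto simp: angle_strip_def)

lemma slit_plane_iff: "z \<in> slit_plane \<longleftrightarrow> (Im z = 0 \<longrightarrow> \<bar>Re z\<bar> \<le> 1)"
  by (auto simp: slit_plane_def complex_eq_iff abs_le_iff)

lemma cos_strip_in_slit_plane:
  assumes "z \<in> angle_strip" shows "cos z \<in> slit_plane"
proof (cases "Im z = 0")
  case True
  then have "z = of_real (Re z)" by (simp add: complex_eq_iff)
  then have "cos z = of_real (cos (Re z))" by (metis cos_of_real)
  then show ?thesis by (simp add: slit_plane_iff)
next
  case False
  then have r: "0 < Re z" "Re z < pi" using assms by (auto simp: angle_strip_def)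
  have "sin (Re z) > 0" using r by (simp add: sin_gt_zero)
  then have "Im (cos z) \<noteq> 0" using False by (simp add: Im_cos)
  then show ?thesis by (simp add: slit_plane_iff)
qed

lemma Arccos_in_strip:
  assumes "z \<in> slit_plane" shows "Arccos z \<in> angle_strip"
proof (cases "Im z = 0")
  case True
  then have "\<bar>Re z\<bar> \<le> 1" using assms by (simp add: slit_plane_iff)
  moreover have "z = of_real (Re z)" using True by (simp add: complex_eq_iff)
  ultimately have *: "Arccos z = of_real (arccos (Re z))" by (metis of_real_arccos abs_le_iff minus_le_iff arccos_eq_Re_Arccos)
  have "0 \<le> arccos (Re z)" "arccos (Re z) \<le> pi"
    using \<open>\<bar>Re z\<bar> \<le> 1\<close> by (auto intro: arccos_lbound arccos_ubound)
  then show ?thesis unfolding * by (force simp: angle_strip_def complex_eq_iff)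
next
  case False
  let ?w = "Arccos z"
  have bounds: "- pi < Re ?w" "Re ?w \<le> pi" using Re_Arccos_bounds[of z] by auto
  have "Im (cos ?w) = sin (Re ?w) * (exp (- Im ?w) - exp (Im ?w)) / 2" by (rule Im_cos)
  then have "sin (Re ?w) \<noteq> 0" using False by auto
  then have ne: "Re ?w \<noteq> 0" "Re ?w \<noteq> pi" by auto
  have "\<not> Re ?w < 0"
  proof
    assume "Re ?w < 0"
    moreover from this have "?w = - ?w" using bounds by (intro Arccos_unique) auto
    ultimately show False by (simp add: complex_eq_iff)
  qed
  then have "0 < Re ?w" "Re ?w < pi" using bounds ne by auto
  then show ?thesis by (auto simp: angle_strip_def complex_eq_iff)
qed

lemma bij_betw_cos_strip: "bij_betw cos angle_strip slit_plane"
  by (rule bij_betw_byWitness[where f' = Arccos])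
     (auto simp: Arccos_cos_strip cos_strip_in_slit_plane Arccos_in_strip)

lemma strip_arccos_eq_Arccos: "z \<in> slit_plane \<Longrightarrow> strip_arccos z = Arccos z"
  unfolding strip_arccos_def
  by (rule the_inv_into_f_eq) (use bij_betw_cos_strip Arccos_in_strip in \<open>auto simp: bij_betw_def\<close>)

end

theory Submission
  imports Defs
begin

text \<open>Let \<open>c = \<langle>x|y\<rangle>\<close>. Both angles on the right-hand side are arc cosines of
  \<open>q = (1 + c) / \<parallel>x + y\<parallel>\<close>, where \<open>\<parallel>x + y\<parallel>\<^sup>2 = 2 + 2 Re c\<close>. Applying the cosine to
  \<open>arccos c = 2 arccos q\<close> yields \<open>c = 2 q\<^sup>2 - 1\<close>, that is \<open>(1 + c)\<^sup>2 = (1 + Re c) (1 + c)\<close>, so that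
  \<open>c = Re c\<close>. For real \<open>c\<close>, the equation is the half-angle formula.\<close>

text \<open>Both sides have cosine \<open>a\<close> and lie in the interval from 0 to
  \<open>pi\<close>, where the cosine is injective. The nonnegative root keeps its
  \<open>arccos\<close> at most \<open>pi / 2\<close>.\<close>

lemma arccos_half_angle:
  fixes a :: real
  assumes "-1 \<le> a" "a \<le> 1"
  shows "arccos a = 2 * arccos (sqrt ((1 + a) / 2))"
proof -
  let ?s = "sqrt ((1 + a) / 2)"
  have s: "0 \<le> ?s" "?s \<le> 1"
    using assms by auto
  have "cos (arccos ?s) = ?s"
    using s by (intro cos_arccos) linarith+
  then have "cos (2 * arccos ?s) = 2 * ?s\<^sup>2 - 1"
    by (simp only: cos_double_cos)
  also have "\<dots> = a"
    using assms by (simp add: field_simps)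
  finally have "cos (2 * arccos ?s) = a" .
  moreover have "0 \<le> 2 * arccos ?s" "2 * arccos ?s \<le> pi"
    using s arccos_lbound[of ?s] arccos_le_pi2[of ?s] by linarith+
  ultimately show ?thesis
    using arccos_cos by metis
qed

lemma strip_arccos_of_real:
  assumes "\<bar>a\<bar> \<le> 1"
  shows "strip_arccos (of_real a) = of_real (arccos a)"
  using assms by (simp add: strip_arccos_eq_Arccos slit_plane_iff of_real_arccos)

lemma cos_strip_arccos: "z \<in> slit_plane \<Longrightarrow> cos (strip_arccos z) = z"
  by (simp add: strip_arccos_eq_Arccos)

text \<open>The cosine of a real number is real, and a real point of \<open>slit_plane\<close> lies
  between -1 and 1, where \<open>strip_arccos\<close> is the real \<open>arccos\<close>.\<close>

lemma strip_arccos_in_Reals_iff: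
  assumes "z \<in> slit_plane"
  shows "strip_arccos z \<in> \<real> \<longleftrightarrow> z \<in> \<real>"
proof
  assume "strip_arccos z \<in> \<real>"
  then obtain t where "strip_arccos z = of_real t"
    by (auto elim: Reals_cases)
  then show "z \<in> \<real>"
    using cos_strip_arccos[OF assms] by (metis Reals_of_real cos_of_real)
next
  assume "z \<in> \<real>"
  then obtain a where "z = of_real a"
    by (auto elim: Reals_cases)
  with assms show "strip_arccos z \<in> \<real>"
    by (simp add: slit_plane_iff strip_arccos_of_real)
qed

lemma strip_arccos_eq_double_iff:
  assumes c: "c \<in> slit_plane" and pos: "-1 < Re c"
  defines "q \<equiv> (1 + c) / of_real (sqrt (2 + 2 * Re c))"
  shows "strip_arccos c = 2 * strip_arccos q \<longleftrightarrow> c \<in> \<real>"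
proof
  define r where "r = sqrt (2 + 2 * Re c)"
  have r: "r > 0" "r\<^sup>2 = 2 * (1 + Re c)"
    using pos by (simp_all add: r_def)
  have q_r: "q = (1 + c) / of_real r"
    by (simp only: q_def r_def)
  assume eq: "strip_arccos c = 2 * strip_arccos q"
  show "c \<in> \<real>"
  proof (rule ccontr)
    assume "c \<notin> \<real>"
    \<comment> \<open>\<open>q\<close> is a positive real multiple of \<open>1 + c\<close>, so it is
      nonreal as well. This alone puts it in \<open>slit_plane\<close>, where \<open>cos\<close>
      undoes \<open>strip_arccos\<close>.\<close>
    then have "Im q \<noteq> 0"
      using r by (simp add: q_r complex_is_Real_iff)
    then have q: "q \<in> slit_plane"
      by (simp add: slit_plane_iff)
    have "1 + c = 2 * q\<^sup>2"
      using cos_strip_arccos[OF c] cos_strip_arccos[OF q] eq by (auto simp: cos_double_cos)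
    also have "q\<^sup>2 = (1 + c)\<^sup>2 / (2 * (1 + of_real (Re c)))"
      by (simp add: q_r power_divide r(2) flip: of_real_power)
    finally have "1 + c = (1 + c)\<^sup>2 / (1 + of_real (Re c))"
      by (simp only: times_divide_eq_right mult_divide_mult_cancel_left_if) simp
    \<comment> \<open>Both numbers have the positive real part \<open>1 + Re c\<close>, so the
      denominator can be cleared and one factor \<open>1 + c\<close> cancelled.\<close>
    moreover have "1 + of_real (Re c) \<noteq> (0::complex)" "1 + c \<noteq> 0"
      using pos by (auto simp: complex_eq_iff)
    ultimately have "1 + of_real (Re c) = 1 + c"
      by (simp add: eq_divide_eq power2_eq_square)
    with \<open>c \<notin> \<real>\<close> show False
      by (metis Reals_of_real add_left_cancel)
  qed
next
  assume "c \<in> \<real>"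
  then obtain a where a: "c = of_real a"
    by (auto elim: Reals_cases)
  have bnd: "-1 < a" "a \<le> 1"
    using c pos by (auto simp: a slit_plane_iff)
  have "(1 + a) / sqrt (2 + 2 * a) = sqrt ((1 + a) / 2)"
  proof (rule real_sqrt_unique[symmetric])
    show "((1 + a) / sqrt (2 + 2 * a))\<^sup>2 = (1 + a) / 2"
      using bnd by (simp add: power_divide divide_simps) (simp add: algebra_simps power2_eq_square)
  qed (use bnd in simp)
  then have "q = of_real (sqrt ((1 + a) / 2))"
    unfolding q_def a by (metis Re_complex_of_real of_real_1 of_real_add of_real_divide)
  then show "strip_arccos c = 2 * strip_arccos q"
    using bnd by (simp add: a strip_arccos_of_real arccos_half_angle[of a])
qed

context complex_inner_product_space
begin

lemma ip_add_right: "ip x (y + z) = ip x y + ip x z"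
  by (metis ip_add_left ip_cnj complex_cnj_add)

lemma ip_zero_left: "ip 0 y = 0"
  using ip_add_left[of 0 0 y] by simp

lemma ip_diff_left: "ip (x - y) z = ip x z - ip y z"
  using ip_add_left[of "x - y" y z] by simp

lemma ip_diff_right: "ip x (y - z) = ip x y - ip x z"
  using ip_add_right[of x "y - z" z] by simp

lemma Re_ip_self_nonneg: "0 \<le> Re (ip x x)"
  using ip_pos_def[of x] by (cases "x = 0") (auto simp: ip_zero_left)

text \<open>Conjugate symmetry makes \<open>ip x x\<close> real, so taking \<open>Re\<close> in
  \<open>ip_norm\<close> loses nothing.\<close>

lemma ip_self: "ip x x = of_real ((ip_norm ip x)\<^sup>2)"
proof -
  have "Im (ip x x) = 0"
    using ip_cnj[of x x] by (simp add: complex_eq_iff)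
  then show ?thesis
    using Re_ip_self_nonneg[of x] by (simp add: ip_norm_def complex_eq_iff)
qed

lemma ip_norm_add_unit:
  assumes "ip_norm ip x = 1" "ip_norm ip y = 1"
  shows "ip_norm ip (x + y) = sqrt (2 + 2 * Re (ip x y))"
  using assms ip_cnj[of y x] by (simp add: ip_norm_def[of ip "x + y"] ip_add_left ip_add_right ip_self[of x] ip_self[of y])

text \<open>Expand the squared norm of \<open>x - y\<close>, which is
  \<open>2 - 2 * Re (ip x y)\<close>.\<close>

lemma Re_ip_unit_le_1:
  assumes "ip_norm ip x = 1" "ip_norm ip y = 1"
  shows "Re (ip x y) \<le> 1"
  using assms Re_ip_self_nonneg[of "x - y"] ip_cnj[of y x]
  by (simp add: ip_diff_left ip_diff_right ip_self[of x] ip_self[of y])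

text \<open>Positive definiteness makes the squared norm of \<open>x + y\<close>, which is
  \<open>2 + 2 * Re (ip x y)\<close>, strictly positive.\<close>

lemma Re_ip_unit_gt_minus_1:
  assumes "ip_norm ip x = 1" "ip_norm ip y = 1" "x + y \<noteq> 0"
  shows "-1 < Re (ip x y)"
  using assms ip_pos_def[of "x + y"] ip_cnj[of y x]
  by (simp add: ip_add_left ip_add_right ip_self[of x] ip_self[of y])

end

theorem proposition4p6:
  fixes scale :: "complex \<Rightarrow> 'a::ab_group_add \<Rightarrow> 'a"
    and ip :: "'a \<Rightarrow> 'a \<Rightarrow> complex"
    and x y :: 'a
  assumes "complex_inner_product_space scale ip"
    and "ip_norm ip x = 1" and "ip_norm ip y = 1"
    and "x + y \<noteq> 0"
  shows "(ip_angle ip x y = ip_angle ip x (x + y) + ip_angle ip (x + y) y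
            \<longleftrightarrow> (x, y) \<in> real_pairs ip)
       \<and> ((x, y) \<in> real_pairs ip \<longleftrightarrow> ip_angle ip x y \<in> \<real>)"
proof -
  interpret complex_inner_product_space scale ip
    by fact
  define c where "c = ip x y"
  define q where "q = (1 + c) / of_real (sqrt (2 + 2 * Re c))"
  have pos: "-1 < Re c" and le: "Re c \<le> 1"
    using Re_ip_unit_gt_minus_1 Re_ip_unit_le_1 assms by (auto simp: c_def)
  \<comment> \<open>Only real points are missing from \<open>slit_plane\<close>, so bounds on the
    real part suffice here.\<close>
  then have slit: "c \<in> slit_plane"
    by (simp add: slit_plane_iff abs_le_iff)
  have xy: "ip_angle ip x y = strip_arccos c"
    by (simp add: ip_angle_def c_def assms)
  \<comment> \<open>As \<open>x\<close> and \<open>y\<close> are unit vectors, both inner products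
    with \<open>x + y\<close> equal \<open>1 + c\<close>.\<close>
  have "ip_angle ip x (x + y) = strip_arccos q" "ip_angle ip (x + y) y = strip_arccos q"
    using assms(2,3)
    by (simp_all add: ip_angle_def ip_norm_add_unit ip_add_left ip_add_right ip_self c_def q_def add.commute)
  then show ?thesis
    using strip_arccos_eq_double_iff[OF slit pos] strip_arccos_in_Reals_iff[OF slit]
    by (simp add: xy real_pairs_def c_def q_def)
qed

end
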